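(* Let $\mathcal{J}$ be an analytic P-ideal on $\omega$. Then $\mathcal{J}$ is representable in some (real) Banach space if and only if $\mathcal{J}$ is non-pathological.
   Context: An ideal on $\omega$ is a proper ideal of subsets of $\omega$ containing all finite sets; it is an analytic P-ideal if it is an analytic subset of $2^\omega$ and for every countable $\mathcal{C}\subseteq\mathcal{J}$ there is $A\in\mathcal{J}$ with $C\setminus A$ finite for all $C\in\mathcal{C}$. A submeasure on $\omega$ is $\varphi\colon\mathcal{P}(\omega)\to[0,\infty]$ with $\varphi(\emptyset)=0$, $\varphi(X)\le\varphi(X\cup Y)\le\varphi(X)+\varphi(Y)$, and $\varphi(\{n\})<\infty$ for all $n$; it is lower semicontinuous (lsc) if $\varphi(X)=\lim_n\varphi(X\cap n)$ for all $X$. $\mathrm{Exh}(\varphi)=\{X\subseteq\omega:\lim_{n\to\infty}\varphi(X\setminus n)=0\}$. An lsc submeasure $\varphi$ is non-pathological if for every $A\subseteq\omega$, $\varphi(A)=\sup\{\mu(A):\mu$ a (countably additive) measure on $\mathcal{P}(\omega)$ with $\mu(B)\le\varphi(B)$ for all $B\subseteq\omega\}$. An analytic P-ideal is non-pathological if it equals $\mathrm{Exh}(\varphi)$ for some non-pathological lsc submeasure $\varphi$. For a Banach space $X$ and $h\colon\omega\to X$ with $\sum_{n\in\omega}h(n)$ not unconditionally convergent, let $\mathcal{I}^X_h=\{A\subseteq\omega:\sum_{n\in A}h(n)$ converges unconditionally in $X\}$ (finite sets included); an ideal $\mathcal{J}$ is representable in $X$ if $\mathcal{J}=\mathcal{I}^X_h$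 for some such $h$. *)

theory Defs
  imports "HOL-Analysis.Analysis"
begin

section \<open>Analytic P-ideals on the natural numbers\<close>

definition ideal_on_nat :: "nat set set \<Rightarrow> bool" where
  "ideal_on_nat J \<longleftrightarrow>
     UNIV \<notin> J \<and>
     (\<forall>A. finite A \<longrightarrow> A \<in> J) \<and>
     (\<forall>A\<in>J. \<forall>B. B \<subseteq> A \<longrightarrow> B \<in> J) \<and>
     (\<forall>A\<in>J. \<forall>B\<in>J. A \<union> B \<in> J)"

text \<open>Analytic sets as continuous images of the Baire space, here the function type
  \<^typ>\<open>nat \<Rightarrow> nat\<close> with the product topology.\<close>

definition analytic_set :: "'a::topological_space set \<Rightarrow> bool" where
  "analytic_set S \<longleftrightarrow>
     S = {} \<or> (\<exists>f :: (nat \<Rightarrow> nat) \<Rightarrow> 'a. continuous_on UNIV f \<and> range f = S)"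

text \<open>A family of subsets of the natural numbers is a subset of the Cantor space
  \<^typ>\<open>nat \<Rightarrow> bool\<close> (product of discrete spaces) via characteristic functions.\<close>

definition analytic_P_ideal :: "nat set set \<Rightarrow> bool" where
  "analytic_P_ideal J \<longleftrightarrow>
     ideal_on_nat J \<and>
     analytic_set ((\<lambda>A n. n \<in> A) ` J) \<and>
     (\<forall>C. countable C \<and> C \<subseteq> J \<longrightarrow> (\<exists>A\<in>J. \<forall>B\<in>C. finite (B - A)))"


section \<open>Submeasures and non-pathological ideals\<close>

definition submeasure :: "(nat set \<Rightarrow> ennreal) \<Rightarrow> bool" where
  "submeasure \<phi> \<longleftrightarrow>
     \<phi> {} = 0 \<and>
     (\<forall>X Y. \<phi> X \<le> \<phi> (X \<union> Y) \<and> \<phi> (X \<union> Y) \<le> \<phi> X + \<phi> Y) \<and>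
     (\<forall>n. \<phi> {n} < \<infinity>)"

definition lsc_submeasure :: "(nat set \<Rightarrow> ennreal) \<Rightarrow> bool" where
  "lsc_submeasure \<phi> \<longleftrightarrow>
     submeasure \<phi> \<and> (\<forall>X. (\<lambda>n. \<phi> (X \<inter> {..<n})) \<longlonglongrightarrow> \<phi> X)"

definition Exh :: "(nat set \<Rightarrow> ennreal) \<Rightarrow> nat set set" where
  "Exh \<phi> = {X. (\<lambda>n. \<phi> (X - {..<n})) \<longlonglongrightarrow> 0}"

definition nonpathological_submeasure :: "(nat set \<Rightarrow> ennreal) \<Rightarrow> bool" where
  "nonpathological_submeasure \<phi> \<longleftrightarrow>
     lsc_submeasure \<phi> \<and>
     (\<forall>A. \<phi> A = (SUP M \<in> {M :: nat measure. sets M = UNIV \<and> (\<forall>B. emeasure M B \<le> \<phi> B)}.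
                  emeasure M A))"

definition nonpathological_ideal :: "nat set set \<Rightarrow> bool" where
  "nonpathological_ideal J \<longleftrightarrow> (\<exists>\<phi>. nonpathological_submeasure \<phi> \<and> J = Exh \<phi>)"


section \<open>Representability in Banach spaces\<close>

text \<open>One cannot quantify existentially over the types of class \<^class>\<open>banach\<close>. So that Banach
  spaces can be bound inside a formula, a Banach space is given here by a linear subspace \<open>X\<close> of an
  arbitrary ambient real vector space together with an arbitrary complete norm \<open>N\<close> on \<open>X\<close>. The
  ambient space carries no topology, and the values of \<open>N\<close> outside \<open>X\<close> are irrelevant.\<close>

definition banach_space_on :: "'a::real_vector set \<Rightarrow> ('a \<Rightarrow> real) \<Rightarrow> bool" where
  "banach_space_on X N \<longleftrightarrow>
     subspace X \<and>
     (\<forall>x\<in>X. 0 \<le> N x) \<and>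
     (\<forall>x\<in>X. N x = 0 \<longleftrightarrow> x = 0) \<and>
     (\<forall>c. \<forall>x\<in>X. N (c *\<^sub>R x) = \<bar>c\<bar> * N x) \<and>
     (\<forall>x\<in>X. \<forall>y\<in>X. N (x + y) \<le> N x + N y) \<and>
     (\<forall>s. range s \<subseteq> X \<and> (\<forall>e>0. \<exists>k::nat. \<forall>m\<ge>k. \<forall>n\<ge>k. N (s m - s n) < e)
        \<longrightarrow> (\<exists>x\<in>X. (\<lambda>n. N (s n - x)) \<longlonglongrightarrow> 0))"

text \<open>Unconditional convergence is, as for \<^const>\<open>summable_on\<close>, convergence of the net of finite
  partial sums; in particular the sum over a finite \<open>A\<close> always converges.\<close>

definition unconditionally_convergent_on ::
  "'a::real_vector set \<Rightarrow> ('a \<Rightarrow> real) \<Rightarrow> (nat \<Rightarrow> 'a) \<Rightarrow> nat set \<Rightarrow> bool" where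
  "unconditionally_convergent_on X N h A \<longleftrightarrow>
     (\<exists>x\<in>X. ((\<lambda>F. N ((\<Sum>n\<in>F. h n) - x)) \<longlongrightarrow> 0) (finite_subsets_at_top A))"

definition representable_in ::
  "'a::real_vector set \<Rightarrow> ('a \<Rightarrow> real) \<Rightarrow> nat set set \<Rightarrow> bool" where
  "representable_in X N J \<longleftrightarrow>
     (\<exists>h. range h \<subseteq> X \<and>
          \<not> unconditionally_convergent_on X N h UNIV \<and>
          J = {A. unconditionally_convergent_on X N h A})"

text \<open>Agreement with the library notions for spaces of class \<^class>\<open>banach\<close>.\<close>

lemma banach_space_on_UNIV: "banach_space_on (UNIV :: 'a::banach set) norm"
proof -
  have "\<exists>x. (\<lambda>n. norm (s n - x)) \<longlonglongrightarrow> 0"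
    if "\<forall>e>0. \<exists>k::nat. \<forall>m\<ge>k. \<forall>n\<ge>k. norm (s m - s n) < e" for s :: "nat \<Rightarrow> 'a"
  proof -
    have "Cauchy s"
      using that by (simp add: Cauchy_def dist_norm)
    then obtain x where "s \<longlonglongrightarrow> x"
      using Cauchy_convergent convergent_def by blast
    then show ?thesis
      using LIM_zero tendsto_norm_zero by blast
  qed
  then show ?thesis
    by (auto simp: banach_space_on_def norm_triangle_ineq)
qed

lemma unconditionally_convergent_on_UNIV:
  fixes h :: "nat \<Rightarrow> 'a::banach"
  shows "unconditionally_convergent_on UNIV norm h A \<longleftrightarrow> h summable_on A"
  unfolding unconditionally_convergent_on_def summable_on_def has_sum_def
    tendsto_norm_zero_iff LIM_zero_iff by simp

text \<open>Every Banach space has an isometric copy inside any product with a further vector space, and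
  the copy represents the same ideals.\<close>

lemma banach_space_on_times:
  fixes X :: "'a::real_vector set"
  assumes "banach_space_on X N"
  shows "banach_space_on (X \<times> {0 :: 'b::real_vector}) (N \<circ> fst)"
proof -
  have sub: "subspace X"
    using assms by (simp add: banach_space_on_def)
  have X_complete: "\<And>s. range s \<subseteq> X \<Longrightarrow> \<forall>e>0. \<exists>k::nat. \<forall>m\<ge>k. \<forall>n\<ge>k. N (s m - s n) < e
      \<Longrightarrow> \<exists>x\<in>X. (\<lambda>n. N (s n - x)) \<longlonglongrightarrow> 0"
    using assms by (simp add: banach_space_on_def)
  have compl: "\<exists>x\<in>X \<times> {0::'b}. (\<lambda>n. (N \<circ> fst) (s n - x)) \<longlonglongrightarrow> 0"
    if s: "range s \<subseteq> X \<times> {0::'b}"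
      and C: "\<forall>e>0. \<exists>k::nat. \<forall>m\<ge>k. \<forall>n\<ge>k. (N \<circ> fst) (s m - s n) < e" for s
  proof -
    have "range (fst \<circ> s) \<subseteq> X"
      using s by fastforce
    moreover have "\<forall>e>0. \<exists>k::nat. \<forall>m\<ge>k. \<forall>n\<ge>k. N ((fst \<circ> s) m - (fst \<circ> s) n) < e"
      using C by simp
    ultimately obtain x where "x \<in> X" "(\<lambda>n. N ((fst \<circ> s) n - x)) \<longlonglongrightarrow> 0"
      using X_complete[of "fst \<circ> s"] by metis
    then show ?thesis
      by (intro bexI[of _ "(x, 0)"]) auto
  qed
  have "subspace (X \<times> {0::'b})"
    using sub by (intro subspace_Times) auto
  moreover have "\<forall>x\<in>X \<times> {0::'b}. 0 \<le> (N \<circ> fst) x"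
    and "\<forall>x\<in>X \<times> {0::'b}. (N \<circ> fst) x = 0 \<longleftrightarrow> x = 0"
    and "\<forall>c. \<forall>x\<in>X \<times> {0::'b}. (N \<circ> fst) (c *\<^sub>R x) = \<bar>c\<bar> * (N \<circ> fst) x"
    and "\<forall>x\<in>X \<times> {0::'b}. \<forall>y\<in>X \<times> {0::'b}. (N \<circ> fst) (x + y) \<le> (N \<circ> fst) x + (N \<circ> fst) y"
    using assms by (simp_all add: banach_space_on_def zero_prod_def)
  ultimately show ?thesis
    using compl unfolding banach_space_on_def by (intro conjI) simp_all
qed

lemma representable_in_times:
  fixes X :: "'a::real_vector set"
  assumes "representable_in X N J"
  shows "representable_in (X \<times> {0 :: 'b::real_vector}) (N \<circ> fst) J"
proof -
  obtain h where h: "range h \<subseteq> X" "\<not> unconditionally_convergent_on X N h UNIV"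
    "J = {A. unconditionally_convergent_on X N h A}"
    using assms by (auto simp: representable_in_def)
  have fst_sum: "fst (\<Sum>n\<in>F. (h n, 0::'b)) = (\<Sum>n\<in>F. h n)" for F
    by (simp add: fst_sum)
  have "unconditionally_convergent_on (X \<times> {0::'b}) (N \<circ> fst) (\<lambda>n. (h n, 0)) A
      \<longleftrightarrow> unconditionally_convergent_on X N h A" for A
    by (auto simp: unconditionally_convergent_on_def fst_sum)
  then show ?thesis
    using h unfolding representable_in_def
    by (intro exI[of _ "\<lambda>n. (h n, 0)"]) auto
qed

end

theory Submission
  imports Defs
begin

text \<open>For \<open>h\<close> in a Banach space put \<open>\<phi>\<^sub>h A = sup \<parallel>\<Sum>\<^bsub>n\<in>P\<^esub> h n - \<Sum>\<^bsub>n\<in>Q\<^esub> h n\<parallel>\<close> over finite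
  \<open>P, Q \<subseteq> A\<close>. By the Cauchy criterion, \<open>Exh \<phi>\<^sub>h\<close> consists of the sets on which \<open>h\<close> is
  unconditionally summable, and \<open>\<phi>\<^sub>h\<close> is non-pathological: a functional norming
  \<open>\<Sum>\<^bsub>n\<in>P\<^esub> h n - \<Sum>\<^bsub>n\<in>Q\<^esub> h n\<close> on the finite-dimensional span of the \<open>h n\<close> with \<open>n \<in> P \<union> Q\<close> takes
  values \<open>c n\<close> there, and the measure with point masses \<open>\<bar>c n\<bar>\<close> is dominated by \<open>\<phi>\<^sub>h\<close>.
  Conversely, for a non-pathological \<open>\<phi>\<close> countably many dominated measures \<open>\<mu>\<^sub>k\<close> suffice to
  compute \<open>\<phi>\<close> on finite sets, and \<open>h n = (\<mu>\<^sub>k {n})\<^sub>k\<close> in \<open>\<ell>\<^sup>\<infinity>\<close> satisfies \<open>\<phi>\<^sub>h = \<phi>\<close>.\<close>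

section \<open>Norms on subspaces\<close>

lemma banach_space_on_subspace: "banach_space_on X N \<Longrightarrow> subspace X"
  by (simp add: banach_space_on_def)

lemma banach_space_on_nonneg: "banach_space_on X N \<Longrightarrow> x \<in> X \<Longrightarrow> 0 \<le> N x"
  by (simp add: banach_space_on_def)

lemma banach_space_on_zero: "banach_space_on X N \<Longrightarrow> N 0 = 0"
  by (auto simp: banach_space_on_def subspace_0)

lemma banach_space_on_scale: "banach_space_on X N \<Longrightarrow> x \<in> X \<Longrightarrow> N (c *\<^sub>R x) = \<bar>c\<bar> * N x"
  by (simp add: banach_space_on_def)

lemma banach_space_on_triangle:
  "banach_space_on X N \<Longrightarrow> x \<in> X \<Longrightarrow> y \<in> X \<Longrightarrow> N (x + y) \<le> N x + N y"
  by (simp add: banach_space_on_def)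

lemma banach_space_on_minus_commute:
  assumes "banach_space_on X N" "x \<in> X" "y \<in> X"
  shows "N (x - y) = N (y - x)"
  using banach_space_on_scale[OF assms(1), of "x - y" "-1"] assms
  by (simp add: subspace_diff banach_space_on_subspace)

lemma banach_space_on_triangle_diff:
  assumes "banach_space_on X N" "x \<in> X" "y \<in> X" "z \<in> X"
  shows "N (x - z) \<le> N (x - y) + N (y - z)"
  using banach_space_on_triangle[OF assms(1), of "x - y" "y - z"] assms
  by (simp add: subspace_diff banach_space_on_subspace)

lemma banach_space_on_complete:
  assumes "banach_space_on X N" "range s \<subseteq> X"
    and "\<And>e. e > 0 \<Longrightarrow> \<exists>k::nat. \<forall>m\<ge>k. \<forall>n\<ge>k. N (s m - s n) < e"
  obtains x where "x \<in> X" "(\<lambda>n. N (s n - x)) \<longlonglongrightarrow> 0"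
proof -
  have "range s \<subseteq> X \<and> (\<forall>e>0. \<exists>k::nat. \<forall>m\<ge>k. \<forall>n\<ge>k. N (s m - s n) < e)
      \<longrightarrow> (\<exists>x\<in>X. (\<lambda>n. N (s n - x)) \<longlonglongrightarrow> 0)"
    using assms(1) unfolding banach_space_on_def by (elim conjE allE[of _ s])
  then show thesis
    using assms(2,3) that by blast
qed

section \<open>The submeasure of a series\<close>

text \<open>Indices common to \<open>P\<close> and \<open>Q\<close> cancel, so these are the finite
  sums with coefficients -1, 0 and 1. The two signs let the values of a functional count with their
  absolute values. The type is \<open>ennreal\<close> because the supremum over an infinite set may
  be infinite.\<close>

definition signed_variation :: "('a::real_vector \<Rightarrow> real) \<Rightarrow> (nat \<Rightarrow> 'a) \<Rightarrow> nat set \<Rightarrow> ennreal" where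
  "signed_variation N h A =
     (SUP (P, Q) \<in> {(P, Q). finite P \<and> finite Q \<and> P \<subseteq> A \<and> Q \<subseteq> A}. ennreal (N (sum h P - sum h Q)))"

lemma signed_variation_upper:
  assumes "finite P" "finite Q" "P \<subseteq> A" "Q \<subseteq> A"
  shows "ennreal (N (sum h P - sum h Q)) \<le> signed_variation N h A"
  unfolding signed_variation_def using assms by (intro SUP_upper2[of "(P, Q)"]) auto

lemma signed_variation_least:
  assumes "\<And>P Q. finite P \<Longrightarrow> finite Q \<Longrightarrow> P \<subseteq> A \<Longrightarrow> Q \<subseteq> A \<Longrightarrow> ennreal (N (sum h P - sum h Q)) \<le> u"
  shows "signed_variation N h A \<le> u"
  unfolding signed_variation_def using assms by (intro SUP_least) auto

lemma signed_variation_mono: "A \<subseteq> B \<Longrightarrow> signed_variation N h A \<le> signed_variation N h B"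
  by (intro signed_variation_least signed_variation_upper) auto

lemma lsc_submeasure_signed_variation:
  assumes B: "banach_space_on X N" and h: "range h \<subseteq> X"
  shows "lsc_submeasure (signed_variation N h)"
proof -
  let ?\<phi> = "signed_variation N h"
  have sub: "subspace X"
    using B by (rule banach_space_on_subspace)
  have inX: "sum h P \<in> X" for P
    using h by (intro subspace_sum[OF sub]) auto
  have "?\<phi> {} \<le> 0"
    by (rule signed_variation_least) (simp add: banach_space_on_zero[OF B])
  then have empty: "?\<phi> {} = 0"
    by simp
  have union: "?\<phi> (S \<union> T) \<le> ?\<phi> S + ?\<phi> T" for S T
  proof (rule signed_variation_least)
    fix P Q assume fin: "finite P" "finite Q" and PQ: "P \<subseteq> S \<union> T" "Q \<subseteq> S \<union> T"
    \<comment> \<open>Cutting along \<open>S\<close> and its complement, instead of \<open>S\<close>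
      and \<open>T\<close>, keeps indices in the overlap from being counted twice; what lies outside
      \<open>S\<close> is in \<open>T\<close>.\<close>
    have split: "sum h R = sum h (R \<inter> S) + sum h (R - S)" if "finite R" for R
      using that by (metis sum.Int_Diff)
    let ?a = "sum h (P \<inter> S) - sum h (Q \<inter> S)" and ?b = "sum h (P - S) - sum h (Q - S)"
    have ab: "?a \<in> X" "?b \<in> X"
      by (simp_all add: subspace_diff[OF sub] inX)
    have "sum h P - sum h Q = ?a + ?b"
      by (subst split[OF fin(1)], subst split[OF fin(2)]) (simp add: algebra_simps)
    then have "N (sum h P - sum h Q) \<le> N ?a + N ?b"
      using banach_space_on_triangle[OF B ab] by simp
    then have "ennreal (N (sum h P - sum h Q)) \<le> ennreal (N ?a + N ?b)"
      by (rule ennreal_leI)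
    also have "\<dots> = ennreal (N ?a) + ennreal (N ?b)"
      using ab by (simp add: banach_space_on_nonneg[OF B])
    also have "\<dots> \<le> ?\<phi> S + ?\<phi> T"
      using fin PQ by (intro add_mono signed_variation_upper) auto
    finally show "ennreal (N (sum h P - sum h Q)) \<le> ?\<phi> S + ?\<phi> T" .
  qed
  have singleton: "?\<phi> {n} < \<infinity>" for n
  proof -
    have "?\<phi> {n} \<le> ennreal (N (h n))"
    proof (rule signed_variation_least)
      fix P Q assume "P \<subseteq> {n}" "Q \<subseteq> {n}"
      then have "sum h P - sum h Q \<in> {0, h n, - h n}"
        by (auto simp: subset_singleton_iff)
      moreover have "N (- h n) = N (h n)"
        using banach_space_on_minus_commute[OF B, of 0 "h n"] h subspace_0[OF sub] by auto
      ultimately show "ennreal (N (sum h P - sum h Q)) \<le> ennreal (N (h n))"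
        using h by (auto simp: banach_space_on_zero[OF B] banach_space_on_nonneg[OF B])
    qed
    also have "\<dots> < \<infinity>"
      by simp
    finally show ?thesis .
  qed
  have lsc: "(\<lambda>n. ?\<phi> (A \<inter> {..<n})) \<longlonglongrightarrow> ?\<phi> A" for A
  proof -
    have "incseq (\<lambda>n. ?\<phi> (A \<inter> {..<n}))"
      by (auto simp: incseq_def intro!: signed_variation_mono)
    then have "(\<lambda>n. ?\<phi> (A \<inter> {..<n})) \<longlonglongrightarrow> (SUP n. ?\<phi> (A \<inter> {..<n}))"
      by (rule LIMSEQ_SUP)
    moreover have "(SUP n. ?\<phi> (A \<inter> {..<n})) = ?\<phi> A"
    proof (rule antisym)
      show "(SUP n. ?\<phi> (A \<inter> {..<n})) \<le> ?\<phi> A"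
        by (intro SUP_least signed_variation_mono) auto
      show "?\<phi> A \<le> (SUP n. ?\<phi> (A \<inter> {..<n}))"
      proof (rule signed_variation_least)
        fix P Q assume fin: "finite P" "finite Q" and PQ: "P \<subseteq> A" "Q \<subseteq> A"
        \<comment> \<open>Each pair in the supremum is finite, so it already occurs in some initial
          segment of \<open>A\<close>; this gives lower semicontinuity.\<close>
        obtain n where n: "P \<union> Q \<subseteq> {..<n}"
          using fin by (metis finite_Un finite_nat_iff_bounded)
        have "ennreal (N (sum h P - sum h Q)) \<le> ?\<phi> (A \<inter> {..<n})"
          using fin PQ n by (intro signed_variation_upper) auto
        also have "\<dots> \<le> (SUP n. ?\<phi> (A \<inter> {..<n}))"
          by (rule SUP_upper) simp
        finally show "ennreal (N (sum h P - sum h Q)) \<le> (SUP n. ?\<phi> (A \<inter> {..<n}))" .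
      qed
    qed
    ultimately show ?thesis
      by simp
  qed
  show ?thesis
    unfolding lsc_submeasure_def submeasure_def
    using empty union singleton lsc by (auto intro: signed_variation_mono)
qed

section \<open>Exhaustive sets and the Cauchy criterion\<close>

lemma unconditionally_convergent_on_imp_Exh:
  assumes B: "banach_space_on X N" and h: "range h \<subseteq> X"
    and conv: "unconditionally_convergent_on X N h A"
  shows "A \<in> Exh (signed_variation N h)"
proof -
  have sub: "subspace X"
    using B by (rule banach_space_on_subspace)
  have inX: "sum h P \<in> X" for P
    using h by (intro subspace_sum[OF sub]) auto
  obtain x where x: "x \<in> X" and lim: "((\<lambda>F. N (sum h F - x)) \<longlongrightarrow> 0) (finite_subsets_at_top A)"
    using conv by (auto simp: unconditionally_convergent_on_def)
  have "\<forall>\<^sub>F n in sequentially. signed_variation N h (A - {..<n}) < e" if "e > 0" for e :: ennreal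
  proof -
    \<comment> \<open>A finite \<open>d\<close> strictly below \<open>e\<close> leaves room:
      bounding every term of the supremum only gives a non-strict inequality.\<close>
    obtain d where d: "0 < d" "d < e"
      using dense[OF \<open>e > 0\<close>] by blast
    then obtain r where r: "d = ennreal r" "r > 0"
      by (cases d) auto
    have "\<forall>\<^sub>F F in finite_subsets_at_top A. N (sum h F - x) < r / 2"
      using order_tendstoD(2)[OF lim, of "r / 2"] r by simp
    then obtain F where F: "finite F" "F \<subseteq> A"
      "\<forall>G. finite G \<and> F \<subseteq> G \<and> G \<subseteq> A \<longrightarrow> N (sum h G - x) < r / 2"
      unfolding eventually_finite_subsets_at_top by (elim exE conjE)
    obtain k where k: "F \<subseteq> {..<k}"
      using F(1) finite_nat_iff_bounded by blast
    have "signed_variation N h (A - {..<n}) < e" if "n \<ge> k" for n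
    proof -
      have "signed_variation N h (A - {..<n}) \<le> ennreal r"
      proof (rule signed_variation_least)
        fix P Q assume fin: "finite P" "finite Q" and PQ: "P \<subseteq> A - {..<n}" "Q \<subseteq> A - {..<n}"
        \<comment> \<open>Beyond \<open>k\<close> both \<open>P\<close> and \<open>Q\<close> avoid
          \<open>F\<close>, so adding \<open>F\<close> to each leaves the difference unchanged and
          produces two partial sums within \<open>r / 2\<close> of \<open>x\<close>.\<close>
        have "F \<inter> P = {}" "F \<inter> Q = {}"
          using order_trans[OF k lessThan_subset_iff[THEN iffD2, OF \<open>k \<le> n\<close>]] PQ by blast+
        then have eq: "sum h P - sum h Q = sum h (F \<union> P) - sum h (F \<union> Q)"
          by (simp add: sum.union_disjoint[OF F(1) fin(1)] sum.union_disjoint[OF F(1) fin(2)])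
        have "N (sum h (F \<union> P) - sum h (F \<union> Q)) \<le> N (sum h (F \<union> P) - x) + N (x - sum h (F \<union> Q))"
          by (rule banach_space_on_triangle_diff[OF B inX x inX])
        also have "N (x - sum h (F \<union> Q)) = N (sum h (F \<union> Q) - x)"
          by (rule banach_space_on_minus_commute[OF B x inX])
        also have "N (sum h (F \<union> P) - x) < r / 2"
          using F fin PQ by auto
        also have "N (sum h (F \<union> Q) - x) < r / 2"
          using F fin PQ by auto
        finally have "N (sum h P - sum h Q) \<le> r"
          by (simp add: eq)
        then show "ennreal (N (sum h P - sum h Q)) \<le> ennreal r"
          by (rule ennreal_leI)
      qed
      then show ?thesis
        using d r by auto
    qed
    then show ?thesis
      by (auto simp: eventually_sequentially)
  qed
  then have "(\<lambda>n. signed_variation N h (A - {..<n})) \<longlonglongrightarrow> 0"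
    by (intro order_tendstoI) auto
  then show ?thesis
    by (simp add: Exh_def)
qed

text \<open>Finite subsets of \<open>A\<close> that contain \<open>A \<inter> {..<k}\<close> differ
  only beyond \<open>k\<close>, so small tails make the net of partial sums Cauchy. Completeness is
  stated for sequences; the limit is therefore found along initial segments and then shown to be the
  limit of the whole net.\<close>

lemma Exh_imp_unconditionally_convergent_on:
  assumes B: "banach_space_on X N" and h: "range h \<subseteq> X"
    and A: "A \<in> Exh (signed_variation N h)"
  shows "unconditionally_convergent_on X N h A"
proof -
  let ?s = "\<lambda>n. sum h (A \<inter> {..<n})"
  have sub: "subspace X"
    using B by (rule banach_space_on_subspace)
  have inX: "sum h P \<in> X" for P
    using h by (intro subspace_sum[OF sub]) auto
  have tail: "\<exists>k. \<forall>P Q. finite P \<longrightarrow> finite Q \<longrightarrow> A \<inter> {..<k} \<subseteq> P \<longrightarrow> A \<inter> {..<k} \<subseteq> Q \<longrightarrow>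
      P \<subseteq> A \<longrightarrow> Q \<subseteq> A \<longrightarrow> N (sum h P - sum h Q) < e" if "e > 0" for e
  proof -
    have "(\<lambda>n. signed_variation N h (A - {..<n})) \<longlonglongrightarrow> 0"
      using A by (simp add: Exh_def)
    then have "\<forall>\<^sub>F n in sequentially. signed_variation N h (A - {..<n}) < ennreal e"
      using that by (intro order_tendstoD(2)) auto
    then obtain k where k: "signed_variation N h (A - {..<k}) < ennreal e"
      by (auto simp: eventually_sequentially)
    have "N (sum h P - sum h Q) < e"
      if fin: "finite P" "finite Q" and PQ: "A \<inter> {..<k} \<subseteq> P" "A \<inter> {..<k} \<subseteq> Q" "P \<subseteq> A" "Q \<subseteq> A" for P Q
    proof -
      have split: "sum h R = sum h (A \<inter> {..<k}) + sum h (R - {..<k})"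
        if "finite R" "A \<inter> {..<k} \<subseteq> R" "R \<subseteq> A" for R
      proof -
        have "R \<inter> {..<k} = A \<inter> {..<k}"
          using that by auto
        then show ?thesis
          using sum.Int_Diff[OF that(1), of h "{..<k}"] by simp
      qed
      have "sum h P - sum h Q = sum h (P - {..<k}) - sum h (Q - {..<k})"
        by (subst split[OF fin(1) PQ(1,3)], subst split[OF fin(2) PQ(2,4)]) simp
      moreover have "ennreal (N (sum h (P - {..<k}) - sum h (Q - {..<k})))
          \<le> signed_variation N h (A - {..<k})"
        using fin PQ by (intro signed_variation_upper) auto
      ultimately have "ennreal (N (sum h P - sum h Q)) < ennreal e"
        using k by simp
      then show ?thesis
        by (simp add: ennreal_less_iff banach_space_on_nonneg[OF B] subspace_diff[OF sub] inX)
    qed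
    then show ?thesis
      by blast
  qed
  have "range ?s \<subseteq> X"
    using inX by auto
  moreover have "\<exists>k. \<forall>m\<ge>k. \<forall>n\<ge>k. N (?s m - ?s n) < e" if "e > 0" for e
  proof -
    from tail[OF that] obtain k where k: "\<And>P Q. finite P \<Longrightarrow> finite Q \<Longrightarrow> A \<inter> {..<k} \<subseteq> P \<Longrightarrow>
        A \<inter> {..<k} \<subseteq> Q \<Longrightarrow> P \<subseteq> A \<Longrightarrow> Q \<subseteq> A \<Longrightarrow> N (sum h P - sum h Q) < e"
      by blast
    show ?thesis
      by (intro exI[of _ k] allI impI k) auto
  qed
  ultimately obtain x where x: "x \<in> X" and lim: "(\<lambda>n. N (?s n - x)) \<longlonglongrightarrow> 0"
    using banach_space_on_complete[OF B] by blast
  have "\<forall>\<^sub>F F in finite_subsets_at_top A. N (sum h F - x) < e" if "e > 0" for e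
  proof -
    have "e / 2 > 0"
      using that by simp
    from tail[OF this] obtain k where k: "\<And>P Q. finite P \<Longrightarrow> finite Q \<Longrightarrow> A \<inter> {..<k} \<subseteq> P \<Longrightarrow>
        A \<inter> {..<k} \<subseteq> Q \<Longrightarrow> P \<subseteq> A \<Longrightarrow> Q \<subseteq> A \<Longrightarrow> N (sum h P - sum h Q) < e / 2"
      by blast
    have "\<forall>\<^sub>F n in sequentially. N (?s n - x) < e / 2"
      using order_tendstoD(2)[OF lim \<open>e / 2 > 0\<close>] .
    then obtain m where m: "\<And>n. n \<ge> m \<Longrightarrow> N (?s n - x) < e / 2"
      by (auto simp: eventually_sequentially)
    \<comment> \<open>The segment of length \<open>max k m\<close> is long enough both to be
      compared with \<open>F\<close> by the tail bound and to be close to \<open>x\<close>.\<close>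
    have "N (sum h F - x) < e" if F: "finite F" "A \<inter> {..<max k m} \<subseteq> F" "F \<subseteq> A" for F
    proof -
      have "N (sum h F - x) \<le> N (sum h F - ?s (max k m)) + N (?s (max k m) - x)"
        by (rule banach_space_on_triangle_diff[OF B inX inX x])
      also have "N (sum h F - ?s (max k m)) < e / 2"
        using F by (intro k) auto
      also have "N (?s (max k m) - x) < e / 2"
        by (rule m) simp
      finally show ?thesis
        by simp
    qed
    then show ?thesis
      unfolding eventually_finite_subsets_at_top by (intro exI[of _ "A \<inter> {..<max k m}"]) auto
  qed
  moreover have "0 \<le> N (sum h F - x)" for F
    by (simp add: banach_space_on_nonneg[OF B] subspace_diff[OF sub] inX x)
  ultimately have "((\<lambda>F. N (sum h F - x)) \<longlongrightarrow> 0) (finite_subsets_at_top A)"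
    by (intro order_tendstoI) (auto intro: always_eventually less_le_trans)
  then show ?thesis
    using x by (auto simp: unconditionally_convergent_on_def)
qed

lemma Exh_signed_variation:
  assumes "banach_space_on X N" "range h \<subseteq> X"
  shows "Exh (signed_variation N h) = {A. unconditionally_convergent_on X N h A}"
  using unconditionally_convergent_on_imp_Exh[OF assms]
    Exh_imp_unconditionally_convergent_on[OF assms] by blast

section \<open>Norming functionals on finite-dimensional subspaces\<close>

text \<open>Functionals are given by their graphs, which are subspaces of \<open>X \<times> \<real>\<close>.\<close>

lemma hahn_banach_extend_one:
  fixes G :: "('a::real_vector \<times> real) set"
  assumes B: "banach_space_on X N" and y: "y \<in> X" and GX: "G \<subseteq> X \<times> UNIV"
    and dom: "\<And>x r. (x, r) \<in> span G \<Longrightarrow> r \<le> N x"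
  shows "\<exists>s. \<forall>(x, r) \<in> span (insert (y, s) G). r \<le> N x"
proof -
  have sub: "subspace X"
    using B by (rule banach_space_on_subspace)
  have spanX: "x \<in> X" if "(x, r) \<in> span G" for x r
    using span_minimal[OF GX] subspace_Times[OF sub subspace_UNIV] that by auto
  have sep: "r - N (x - y) \<le> N (x' + y) - r'" if "(x, r) \<in> span G" "(x', r') \<in> span G" for x r x' r'
  proof -
    have "(x + x', r + r') \<in> span G"
      using span_add[OF that] by simp
    then have "r + r' \<le> N ((x - y) + (x' + y))"
      using dom by simp
    also have "\<dots> \<le> N (x - y) + N (x' + y)"
      using spanX[OF that(1)] spanX[OF that(2)] y
      by (intro banach_space_on_triangle[OF B]) (auto intro: subspace_diff[OF sub] subspace_add[OF sub])
    finally show ?thesis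
      by simp
  qed
  have zero: "(0, 0) \<in> span G"
    using span_zero[of G] by (simp add: zero_prod_def)
  \<comment> \<open>The least admissible value: the supremum of the lower bounds.\<close>
  define s where "s = (SUP (x, r) \<in> span G. r - N (x - y))"
  have bdd: "bdd_above ((\<lambda>(x, r). r - N (x - y)) ` span G)"
    using sep[OF _ zero] by (auto intro!: bdd_aboveI2[of _ _ "N (0 + y) - 0"])
  have lower: "r - N (x - y) \<le> s" if "(x, r) \<in> span G" for x r
    unfolding s_def using cSUP_upper[OF that bdd] by simp
  have upper: "s \<le> N (x + y) - r" if "(x, r) \<in> span G" for x r
    unfolding s_def using zero sep[OF _ that] by (intro cSUP_least) auto
  have "r \<le> N x" if "(x, r) \<in> span (insert (y, s) G)" for x r
  proof -
    obtain k where "(x, r) - k *\<^sub>R (y, s) \<in> span G"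
      using \<open>(x, r) \<in> _\<close> by (auto simp: span_insert)
    then have k: "(x - k *\<^sub>R y, r - k * s) \<in> span G"
      by simp
    have X: "x \<in> X"
      using subspace_add[OF sub spanX[OF k] subspace_scale[OF sub y, of k]] by simp
    have scaled: "(c *\<^sub>R x - (c * k) *\<^sub>R y, c * r - c * k * s) \<in> span G" for c
      using span_scale[OF k, of c] by (simp add: scaleR_right_diff_distrib right_diff_distrib mult.assoc)
    \<comment> \<open>Scaling by \<open>1 / \<bar>k\<bar>\<close> turns the coefficient of
      \<open>y\<close> into 1 or -1, where the upper bound on \<open>s\<close> (for
      \<open>k > 0\<close>) or the lower bound (for \<open>k < 0\<close>) applies.\<close>
    consider "k = 0" | "k > 0" | "k < 0"
      by linarith
    then show ?thesis
    proof cases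
      case 1
      then show ?thesis
        using dom[OF k] by simp
    next
      case 2
      have "s \<le> N ((1 / k) *\<^sub>R x) - (r / k - s)"
        using upper[OF scaled[of "1 / k"]] 2 by simp
      then have "r / k \<le> N x / k"
        using 2 by (simp add: banach_space_on_scale[OF B X])
      then show ?thesis
        using 2 by (simp add: divide_le_cancel)
    next
      case 3
      have "r / (- k) + s - N ((1 / (- k)) *\<^sub>R x) \<le> s"
        using lower[OF scaled[of "1 / (- k)"]] 3 by simp
      then have "r / (- k) \<le> N x / (- k)"
        using 3 banach_space_on_scale[OF B X, of "1 / (- k)"] by simp
      then show ?thesis
        using 3 by (simp add: divide_le_cancel)
    qed
  qed
  then show ?thesis
    by blast
qed

text \<open>Starting from the line through \<open>(v, N v)\<close> fixes the value at
  \<open>v\<close>; the vectors \<open>h n\<close> with \<open>n\<close> in \<open>F\<close> are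
  then added one by one. As \<open>F\<close> is finite, induction suffices.\<close>

lemma norming_values:
  fixes h :: "nat \<Rightarrow> 'a::real_vector"
  assumes B: "banach_space_on X N" and h: "range h \<subseteq> X" and v: "v \<in> X" and F: "finite F"
  shows "\<exists>c. \<forall>(x, r) \<in> span (insert (v, N v) ((\<lambda>n. (h n, c n)) ` F)). r \<le> N x"
  using F
proof (induction F)
  case empty
  have "k * N v \<le> N (k *\<^sub>R v)" for k
    using banach_space_on_nonneg[OF B v] by (simp add: banach_space_on_scale[OF B v] mult_right_mono)
  then show ?case
    by (auto simp: span_singleton)
next
  case (insert m F)
  then obtain c where c: "\<forall>(x, r) \<in> span (insert (v, N v) ((\<lambda>n. (h n, c n)) ` F)). r \<le> N x"
    by blast
  let ?G = "insert (v, N v) ((\<lambda>n. (h n, c n)) ` F)"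
  have "h m \<in> X" "?G \<subseteq> X \<times> UNIV"
    using h v by auto
  then obtain s where s: "\<forall>(x, r) \<in> span (insert (h m, s) ?G). r \<le> N x"
    using hahn_banach_extend_one[OF B, of "h m" ?G] c by blast
  \<comment> \<open>Since \<open>m\<close> is not in \<open>F\<close>, the new value leaves the
    earlier part of the graph alone.\<close>
  have "(\<lambda>n. (h n, (c(m := s)) n)) ` F = (\<lambda>n. (h n, c n)) ` F"
    using insert.hyps by (intro image_cong) auto
  then have "insert (v, N v) ((\<lambda>n. (h n, (c(m := s)) n)) ` insert m F) = insert (h m, s) ?G"
    by auto
  then show ?case
    using s by (intro exI[of _ "c(m := s)"]) simp
qed

text \<open>The \<open>c n\<close> are the values at \<open>h n\<close> of a functional dominated by
  \<open>N\<close> that norms the given difference. Choosing signs according to \<open>c\<close>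
  writes the sum of absolute values over \<open>E\<close> as the functional at one difference of
  partial sums from \<open>E\<close>.\<close>

lemma norming_coefficients:
  fixes h :: "nat \<Rightarrow> 'a::real_vector"
  assumes B: "banach_space_on X N" and h: "range h \<subseteq> X" and fin: "finite P" "finite Q"
  obtains c where "N (sum h P - sum h Q) \<le> (\<Sum>n\<in>P \<union> Q. \<bar>c n\<bar>)"
    "\<And>E. E \<subseteq> P \<union> Q \<Longrightarrow> ennreal (\<Sum>n\<in>E. \<bar>c n\<bar>) \<le> signed_variation N h E"
proof -
  define F where "F = P \<union> Q"
  have F: "finite F" "P \<subseteq> F" "Q \<subseteq> F"
    using fin by (auto simp: F_def)
  have sub: "subspace X"
    using B by (rule banach_space_on_subspace)
  have inX: "sum h R \<in> X" for R
    using h by (intro subspace_sum[OF sub]) auto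
  let ?v = "sum h P - sum h Q"
  have v: "?v \<in> X"
    by (simp add: subspace_diff[OF sub] inX)
  obtain c where c: "\<forall>(x, r) \<in> span (insert (?v, N ?v) ((\<lambda>n. (h n, c n)) ` F)). r \<le> N x"
    using norming_values[OF B h v F(1)] by blast
  let ?S = "span (insert (?v, N ?v) ((\<lambda>n. (h n, c n)) ` F))"
  have "(\<Sum>n\<in>R. (h n, c n)) \<in> ?S" if "R \<subseteq> F" for R
    using that by (intro span_sum span_base) auto
  then have sumS: "(sum h R, sum c R) \<in> ?S" if "R \<subseteq> F" for R
    using that by (simp add: sum_prod)
  have diffS: "(sum h R - sum h T, sum c R - sum c T) \<in> ?S" if "R \<subseteq> F" "T \<subseteq> F" for R T
    using span_diff[OF sumS[OF that(1)] sumS[OF that(2)]] by simp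
  \<comment> \<open>The norming value and the one computed from \<open>c\<close> sit over the same
    vector; their difference sits over 0, where domination bounds it by
    \<open>N 0 = 0\<close>.\<close>
  have "(?v - ?v, N ?v - (sum c P - sum c Q)) \<in> ?S"
    using span_diff[OF span_base diffS[OF F(2,3)], of "(?v, N ?v)"] by simp
  then have "N ?v - (sum c P - sum c Q) \<le> N 0"
    using c by auto
  then have "N ?v \<le> sum c P - sum c Q"
    by (simp add: banach_space_on_zero[OF B])
  also have "\<dots> = sum c (P - Q) - sum c (Q - P)"
    using sum.Int_Diff[OF fin(1), of c Q] sum.Int_Diff[OF fin(2), of c P] by (simp add: Int_commute)
  also have "\<dots> \<le> (\<Sum>n\<in>P - Q. \<bar>c n\<bar>) + (\<Sum>n\<in>Q - P. \<bar>c n\<bar>)"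
    using sum_abs[of c "P - Q"] sum_abs[of c "Q - P"] by linarith
  also have "\<dots> = (\<Sum>n\<in>(P - Q) \<union> (Q - P). \<bar>c n\<bar>)"
    using fin by (intro sum.union_disjoint[symmetric]) auto
  also have "\<dots> \<le> (\<Sum>n\<in>F. \<bar>c n\<bar>)"
    using F by (intro sum_mono2) auto
  finally have 1: "N ?v \<le> (\<Sum>n\<in>F. \<bar>c n\<bar>)" .
  have 2: "ennreal (\<Sum>n\<in>E. \<bar>c n\<bar>) \<le> signed_variation N h E" if E: "E \<subseteq> F" for E
  proof -
    have finE: "finite E"
      using E F(1) by (rule finite_subset)
    \<comment> \<open>This split by sign is the pair witnessing the bound in
      \<open>signed_variation\<close>.\<close>
    let ?R = "{n\<in>E. c n > 0}" and ?T = "{n\<in>E. \<not> c n > 0}"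
    have "(\<Sum>n\<in>E. \<bar>c n\<bar>) = (\<Sum>n\<in>?R \<union> ?T. \<bar>c n\<bar>)"
      by (rule sum.cong) auto
    also have "\<dots> = (\<Sum>n\<in>?R. \<bar>c n\<bar>) + (\<Sum>n\<in>?T. \<bar>c n\<bar>)"
      using finE by (intro sum.union_disjoint) auto
    also have "\<dots> = (\<Sum>n\<in>?R. c n) + (\<Sum>n\<in>?T. - c n)"
      by (intro arg_cong2[where f = "(+)"] sum.cong) auto
    also have "\<dots> = sum c ?R - sum c ?T"
      by (simp add: sum_negf)
    also have "\<dots> \<le> N (sum h ?R - sum h ?T)"
      using c diffS[of ?R ?T] E by auto
    finally have "ennreal (\<Sum>n\<in>E. \<bar>c n\<bar>) \<le> ennreal (N (sum h ?R - sum h ?T))"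
      by (rule ennreal_leI)
    also have "\<dots> \<le> signed_variation N h E"
      using finE by (intro signed_variation_upper) auto
    finally show ?thesis .
  qed
  show thesis
    using that 1 2 by (simp add: F_def)
qed

lemma nonpathological_signed_variation:
  assumes B: "banach_space_on X N" and h: "range h \<subseteq> X"
  shows "nonpathological_submeasure (signed_variation N h)"
proof -
  let ?D = "{M :: nat measure. sets M = UNIV \<and> (\<forall>B. emeasure M B \<le> signed_variation N h B)}"
  have "signed_variation N h A = (SUP M \<in> ?D. emeasure M A)" for A
  proof (rule antisym)
    show "(SUP M \<in> ?D. emeasure M A) \<le> signed_variation N h A"
      by (rule SUP_least) auto
    show "signed_variation N h A \<le> (SUP M \<in> ?D. emeasure M A)"
    proof (rule signed_variation_least)
      fix P Q assume fin: "finite P" "finite Q" and PQ: "P \<subseteq> A" "Q \<subseteq> A"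
      obtain c where c: "N (sum h P - sum h Q) \<le> (\<Sum>n\<in>P \<union> Q. \<bar>c n\<bar>)"
        "\<And>E. E \<subseteq> P \<union> Q \<Longrightarrow> ennreal (\<Sum>n\<in>E. \<bar>c n\<bar>) \<le> signed_variation N h E"
        using norming_coefficients[OF B h fin] by blast
      define f where "f n = (if n \<in> P \<union> Q then ennreal \<bar>c n\<bar> else 0)" for n
      define M where "M = point_measure UNIV f"
      have M: "emeasure M E = ennreal (\<Sum>n\<in>E \<inter> (P \<union> Q). \<bar>c n\<bar>)" for E
      proof -
        have supp: "{n\<in>E. 0 < f n} \<subseteq> E \<inter> (P \<union> Q)"
          by (auto simp: f_def split: if_splits)
        have finE: "finite (E \<inter> (P \<union> Q))"
          using fin by simp
        have "emeasure M E = (\<Sum>n | n \<in> E \<and> 0 < f n. f n)"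
          unfolding M_def using finite_subset[OF supp finE] by (intro emeasure_point_measure) auto
        also have "\<dots> = (\<Sum>n\<in>E \<inter> (P \<union> Q). f n)"
          using supp finE by (intro sum.mono_neutral_left) auto
        also have "\<dots> = (\<Sum>n\<in>E \<inter> (P \<union> Q). ennreal \<bar>c n\<bar>)"
          by (rule sum.cong) (auto simp: f_def)
        also have "\<dots> = ennreal (\<Sum>n\<in>E \<inter> (P \<union> Q). \<bar>c n\<bar>)"
          by simp
        finally show ?thesis .
      qed
      \<comment> \<open>The bound on \<open>c\<close> covers only subsets of
        \<open>P \<union> Q\<close>; as \<open>M\<close> has no mass elsewhere, monotonicity extends
        it to every \<open>E\<close>.\<close>
      have "emeasure M E \<le> signed_variation N h E" for E
        unfolding M using c(2)[of "E \<inter> (P \<union> Q)"]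
        by (auto intro: order_trans signed_variation_mono)
      then have "M \<in> ?D"
        by (simp add: M_def sets_point_measure)
      moreover have "ennreal (N (sum h P - sum h Q)) \<le> emeasure M A"
        unfolding M using c(1) PQ by (intro ennreal_leI) (simp add: Int_absorb1)
      ultimately show "ennreal (N (sum h P - sum h Q)) \<le> (SUP M \<in> ?D. emeasure M A)"
        by (rule SUP_upper2)
    qed
  qed
  then show ?thesis
    unfolding nonpathological_submeasure_def
    using lsc_submeasure_signed_variation[OF B h] by blast
qed

section \<open>Non-pathological submeasures as variations in the space of bounded sequences\<close>

lemma lsc_submeasure_mono:
  assumes "lsc_submeasure \<phi>" "A \<subseteq> B"
  shows "\<phi> A \<le> \<phi> B"
proof -
  have "\<phi> A \<le> \<phi> (A \<union> B)"
    using assms(1) unfolding lsc_submeasure_def submeasure_def by blast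
  then show ?thesis
    using assms(2) by (simp add: Un_absorb1)
qed

lemma lsc_submeasure_finite:
  assumes \<phi>: "lsc_submeasure \<phi>" and "finite F"
  shows "\<phi> F < \<infinity>"
  using \<open>finite F\<close>
proof induction
  case empty
  then show ?case
    using \<phi> by (simp add: lsc_submeasure_def submeasure_def)
next
  case (insert n F)
  have "\<phi> ({n} \<union> F) \<le> \<phi> {n} + \<phi> F" "\<phi> {n} < \<infinity>"
    using \<phi> unfolding lsc_submeasure_def submeasure_def by blast+
  then show ?case
    using insert.IH by (auto simp: less_top[symmetric] top_unique)
qed

lemma lsc_submeasure_least:
  assumes \<phi>: "lsc_submeasure \<phi>" and "\<And>F. finite F \<Longrightarrow> F \<subseteq> A \<Longrightarrow> \<phi> F \<le> u"
  shows "\<phi> A \<le> u"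
proof -
  have "(\<lambda>n. \<phi> (A \<inter> {..<n})) \<longlonglongrightarrow> \<phi> A"
    using \<phi> by (simp add: lsc_submeasure_def)
  then show ?thesis
    by (rule LIMSEQ_le_const2) (use assms(2) in auto)
qed

text \<open>For each finite set a sequence of dominated measures attains the supremum, and there are
  only countably many finite sets, so the sequences merge into one.\<close>

lemma nonpathological_submeasure_countable:
  assumes "nonpathological_submeasure \<phi>"
  obtains M :: "nat \<Rightarrow> nat measure"
  where "\<And>k. sets (M k) = UNIV" "\<And>k B. emeasure (M k) B \<le> \<phi> B"
    "\<And>F. finite F \<Longrightarrow> \<phi> F = (SUP k. emeasure (M k) F)"
proof -
  define D where "D = {M :: nat measure. sets M = UNIV \<and> (\<forall>B. emeasure M B \<le> \<phi> B)}"
  have sup: "\<phi> A = (SUP M \<in> D. emeasure M A)" for A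
    using assms unfolding nonpathological_submeasure_def D_def by blast
  \<comment> \<open>The zero measure shows that the supremum runs over a nonempty family, as
    choosing a sequence from it requires.\<close>
  have "null_measure (count_space UNIV) \<in> D"
    by (simp add: D_def)
  then have ne: "D \<noteq> {}"
    by blast
  have "\<exists>M. range M \<subseteq> D \<and> \<phi> A = (SUP i::nat. emeasure (M i) A)" for A
  proof -
    obtain f :: "nat \<Rightarrow> ennreal" where f: "range f \<subseteq> (\<lambda>M. emeasure M A) ` D"
      "(SUP M \<in> D. emeasure M A) = (SUP i. f i)"
      using ennreal_SUP_countable_SUP[OF ne] by blast
    have "\<exists>M. M \<in> D \<and> f i = emeasure M A" for i
      using subsetD[OF f(1) rangeI, of i] by auto
    then obtain M where "\<And>i. M i \<in> D" "\<And>i. f i = emeasure (M i) A"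
      by metis
    then show ?thesis
      using f(2) sup[of A] by (intro exI[of _ M]) auto
  qed
  then obtain M where M: "\<And>A. range (M A) \<subseteq> D" "\<And>A. \<phi> A = (SUP i::nat. emeasure (M A i) A)"
    by metis
  \<comment> \<open>The index \<open>k\<close> codes a pair: the binary code of a finite set and a
    position in the sequence chosen for that set.\<close>
  define M' where "M' k = (case prod_decode k of (a, i) \<Rightarrow> M (set_decode a) i)" for k
  have M': "M' k \<in> D" for k
    using M(1) by (auto simp: M'_def split: prod.split)
  have "\<phi> F = (SUP k. emeasure (M' k) F)" if "finite F" for F
  proof (rule antisym)
    have "emeasure (M F i) F \<le> (SUP k. emeasure (M' k) F)" for i
      by (rule SUP_upper2[of "prod_encode (set_encode F, i)"]) (simp_all add: M'_def that)
    then show "\<phi> F \<le> (SUP k. emeasure (M' k) F)"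
      by (subst M(2)) (rule SUP_least)
    show "(SUP k. emeasure (M' k) F) \<le> \<phi> F"
      using M' by (intro SUP_least) (simp add: D_def)
  qed
  then show thesis
    using that[of M'] M' by (simp add: D_def)
qed

text \<open>With \<open>h n\<close> the sequence of masses at \<open>n\<close>, the sum over a
  finite \<open>F\<close> has sup norm equal to the supremum of the measures of \<open>F\<close>,
  which is its submeasure. Signs gain nothing: two numbers in \<open>[0, b]\<close> differ by at
  most \<open>b\<close>, here with \<open>b\<close> the submeasure of
  \<open>P \<union> Q\<close>.\<close>

lemma nonpathological_submeasure_eq_signed_variation:
  assumes np: "nonpathological_submeasure \<phi>"
  obtains h :: "nat \<Rightarrow> (nat \<Rightarrow>\<^sub>C real)" where "signed_variation norm h = \<phi>"
proof -
  have lsc: "lsc_submeasure \<phi>"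
    using np by (simp add: nonpathological_submeasure_def)
  obtain M :: "nat \<Rightarrow> nat measure" where M: "\<And>k. sets (M k) = UNIV"
    "\<And>k B. emeasure (M k) B \<le> \<phi> B" "\<And>F. finite F \<Longrightarrow> \<phi> F = (SUP k. emeasure (M k) F)"
    using nonpathological_submeasure_countable[OF np] by blast
  have fin: "emeasure (M k) F < \<infinity>" if "finite F" for k F
    using M(2)[of k F] lsc_submeasure_finite[OF lsc that] by (rule le_less_trans)
  define h where "h n = Bcontfun (\<lambda>k. measure (M k) {n})" for n
  have "(\<lambda>k. measure (M k) {n}) \<in> bcontfun" for n
  proof (rule bcontfun_normI[where b = "enn2real (\<phi> {n})"])
    show "norm (measure (M k) {n}) \<le> enn2real (\<phi> {n})" for k
      using M(2)[of k "{n}"] lsc_submeasure_finite[OF lsc, of "{n}"]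
      by (simp add: measure_def enn2real_mono)
  qed simp
  then have single: "apply_bcontfun (h n) k = measure (M k) {n}" for n k
    by (simp add: h_def Bcontfun_inverse)
  have sum_apply: "apply_bcontfun (sum h F) k = (\<Sum>n\<in>F. apply_bcontfun (h n) k)" for F k
    by (induction F rule: infinite_finite_induct) auto
  have measure_sum: "measure (M k) F = (\<Sum>n\<in>F. measure (M k) {n})" if "finite F" for F k
    using that fin by (intro measure_eq_sum_singleton) (auto simp: M(1) less_top[symmetric])
  have app: "apply_bcontfun (sum h F) k = measure (M k) F" if "finite F" for F k
    by (simp only: sum_apply single measure_sum[OF that])
  have "signed_variation norm h A = \<phi> A" for A
  proof (rule antisym)
    show "signed_variation norm h A \<le> \<phi> A"
    proof (rule signed_variation_least)
      fix P Q assume PQ: "finite P" "finite Q" "P \<subseteq> A" "Q \<subseteq> A"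
      have \<phi>PQ: "\<phi> (P \<union> Q) < \<infinity>"
        using lsc_submeasure_finite[OF lsc] PQ by simp
      have bd: "measure (M k) R \<le> enn2real (\<phi> (P \<union> Q))" if "R \<subseteq> P \<union> Q" for k R
        using order_trans[OF M(2) lsc_submeasure_mono[OF lsc that]] \<phi>PQ
        by (simp add: measure_def enn2real_mono)
      have "\<bar>measure (M k) P - measure (M k) Q\<bar> \<le> enn2real (\<phi> (P \<union> Q))" for k
        using bd[of P k, OF Un_upper1] bd[of Q k, OF Un_upper2]
          measure_nonneg[of "M k" P] measure_nonneg[of "M k" Q] by linarith
      then have "norm (apply_bcontfun (sum h P - sum h Q) k) \<le> enn2real (\<phi> (P \<union> Q))" for k
        using PQ by (simp add: app)
      then have "norm (sum h P - sum h Q) \<le> enn2real (\<phi> (P \<union> Q))"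
        by (rule norm_bound)
      then have "ennreal (norm (sum h P - sum h Q)) \<le> ennreal (enn2real (\<phi> (P \<union> Q)))"
        by (rule ennreal_leI)
      also have "\<dots> = \<phi> (P \<union> Q)"
        using \<phi>PQ by simp
      also have "\<dots> \<le> \<phi> A"
        using PQ by (intro lsc_submeasure_mono[OF lsc]) auto
      finally show "ennreal (norm (sum h P - sum h Q)) \<le> \<phi> A" .
    qed
    show "\<phi> A \<le> signed_variation norm h A"
    \<comment> \<open>By lower semicontinuity finite \<open>F\<close> suffice, and for these the
      pair \<open>(F, {})\<close> already reaches every \<open>emeasure (M k) F\<close>.\<close>
    proof (rule lsc_submeasure_least[OF lsc])
      fix F assume F: "finite F" "F \<subseteq> A"
      have "emeasure (M k) F \<le> signed_variation norm h A" for k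
      proof -
        have "emeasure (M k) F = ennreal (measure (M k) F)"
          using fin[OF F(1)] by (intro emeasure_eq_ennreal_measure) (auto simp: less_top[symmetric])
        also have "\<dots> \<le> ennreal (norm (sum h F - sum h {}))"
          using norm_bounded[of "sum h F" k] by (intro ennreal_leI) (simp add: app[OF F(1)])
        also have "\<dots> \<le> signed_variation norm h A"
          using F by (intro signed_variation_upper) auto
        finally show ?thesis .
      qed
      then show "\<phi> F \<le> signed_variation norm h A"
        unfolding M(3)[OF F(1)] by (rule SUP_least)
    qed
  qed
  then show thesis
    using that by blast
qed

text \<open>The library has completeness of \<^typ>\<open>'a \<Rightarrow>\<^sub>C 'b\<close> only over a metric space \<^typ>\<open>'a\<close>, and
  \<^typ>\<open>nat\<close> is not one.\<close>

lemma complete_UNIV_bcontfun: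
  "complete (UNIV :: ('a::topological_space \<Rightarrow>\<^sub>C 'b::complete_space) set)"
  unfolding complete_def
proof (intro allI impI)
  fix f :: "nat \<Rightarrow> ('a \<Rightarrow>\<^sub>C 'b)"
  assume f: "(\<forall>n. f n \<in> UNIV) \<and> Cauchy f"
  have "uniformly_Cauchy_on UNIV (\<lambda>n. apply_bcontfun (f n))"
  proof (rule uniformly_Cauchy_onI)
    fix e :: real assume "e > 0"
    then obtain M where "\<forall>m\<ge>M. \<forall>n\<ge>M. dist (f m) (f n) < e"
      using f by (meson Cauchy_def)
    then show "\<exists>M. \<forall>x\<in>UNIV. \<forall>m\<ge>M. \<forall>n\<ge>M. dist (f m x) (f n x) < e"
      by (intro exI[of _ M]) (auto intro: dist_fun_lt_imp_dist_val_lt)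
  qed
  then obtain g where "uniform_limit UNIV f g sequentially"
    using Cauchy_uniformly_convergent uniformly_convergent_on_def by blast
  then obtain l where "f \<longlonglongrightarrow> l"
    using uniform_limit_bcontfunE[OF _ sequentially_bot] by metis
  then show "\<exists>l\<in>UNIV. f \<longlonglongrightarrow> l"
    by blast
qed

section \<open>Transfer to the ambient product and the equivalence\<close>

lemma banach_space_on_times_left:
  assumes "complete (UNIV :: 'b::real_normed_vector set)"
  shows "banach_space_on ({0 :: 'u::real_vector} \<times> (UNIV :: 'b set)) (norm \<circ> snd)"
proof -
  let ?X = "{0 :: 'u} \<times> (UNIV :: 'b set)"
  have "\<exists>x\<in>?X. (\<lambda>n. (norm \<circ> snd) (s n - x)) \<longlonglongrightarrow> 0"
    if "\<forall>e>0. \<exists>k::nat. \<forall>m\<ge>k. \<forall>n\<ge>k. (norm \<circ> snd) (s m - s n) < e" for s :: "nat \<Rightarrow> 'u \<times> 'b"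
  proof -
    have "Cauchy (\<lambda>n. snd (s n))"
      using that by (simp add: Cauchy_def dist_norm)
    then obtain x where "(\<lambda>n. snd (s n)) \<longlonglongrightarrow> x"
      using assms unfolding complete_def by blast
    then have "(\<lambda>n. norm (snd (s n) - x)) \<longlonglongrightarrow> 0"
      using LIM_zero tendsto_norm_zero by blast
    then show ?thesis
      by (intro bexI[of _ "(0, x)"]) auto
  qed
  moreover have "subspace ?X"
    by (intro subspace_Times) auto
  ultimately show ?thesis
    unfolding banach_space_on_def
    by (intro conjI) (simp_all add: zero_prod_def norm_triangle_ineq mem_Times_iff prod_eq_iff)
qed

(* The type variable 'u is arbitrary, so the Banach spaces quantified over include a copy of every
   Banach space (banach_space_on_times, representable_in_times). The second factor only ensures that
   the ambient space is not too small to contain infinite-dimensional Banach spaces. *)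

theorem theorem5p3:
  fixes J :: "nat set set"
  assumes "analytic_P_ideal J"
  shows "(\<exists>(X :: ('u::real_vector \<times> (nat \<Rightarrow>\<^sub>C real)) set) N.
            banach_space_on X N \<and> representable_in X N J)
         \<longleftrightarrow> nonpathological_ideal J"
proof
  assume "\<exists>(X :: ('u \<times> (nat \<Rightarrow>\<^sub>C real)) set) N. banach_space_on X N \<and> representable_in X N J"
  then obtain X :: "('u \<times> (nat \<Rightarrow>\<^sub>C real)) set" and N h where B: "banach_space_on X N"
    and h: "range h \<subseteq> X" and J: "J = {A. unconditionally_convergent_on X N h A}"
    by (auto simp: representable_in_def)
  then show "nonpathological_ideal J"
    unfolding nonpathological_ideal_def
    using nonpathological_signed_variation[OF B h] Exh_signed_variation[OF B h] by blast
next
  assume "nonpathological_ideal J"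
  then obtain \<phi> where \<phi>: "nonpathological_submeasure \<phi>" and J: "J = Exh \<phi>"
    by (auto simp: nonpathological_ideal_def)
  obtain h :: "nat \<Rightarrow> (nat \<Rightarrow>\<^sub>C real)" where h: "signed_variation norm h = \<phi>"
    using nonpathological_submeasure_eq_signed_variation[OF \<phi>] by blast
  let ?X = "{0 :: 'u} \<times> (UNIV :: (nat \<Rightarrow>\<^sub>C real) set)" and ?h = "\<lambda>n. (0 :: 'u, h n)"
  have "signed_variation (norm \<circ> snd) ?h = signed_variation norm h"
    by (simp add: fun_eq_iff signed_variation_def snd_sum)
  moreover have B: "banach_space_on ?X (norm \<circ> snd)"
    by (rule banach_space_on_times_left[OF complete_UNIV_bcontfun])
  then have "Exh (signed_variation (norm \<circ> snd) ?h)
      = {A. unconditionally_convergent_on ?X (norm \<circ> snd) ?h A}"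
    by (rule Exh_signed_variation) auto
  ultimately have "J = {A. unconditionally_convergent_on ?X (norm \<circ> snd) ?h A}"
    by (simp only: J h)
  \<comment> \<open>Properness of the ideal is exactly the demand that the whole series not converge
    unconditionally.\<close>
  moreover have "UNIV \<notin> J"
    using assms by (simp add: analytic_P_ideal_def ideal_on_nat_def)
  ultimately have "representable_in ?X (norm \<circ> snd) J"
    unfolding representable_in_def by (intro exI[of _ ?h]) auto
  then show "\<exists>(X :: ('u \<times> (nat \<Rightarrow>\<^sub>C real)) set) N. banach_space_on X N \<and> representable_in X N J"
    using B by blast
qed

end
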